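(* Let $A$ be a pseudo-BCI algebra and $d:A\to A$ a map. Then $d$ is a regular type II implicative derivation on $A$ if and only if $d(1)=1$ and $d(x\to y)=x\to d(y)$ and $d(x\rightsquigarrow y)=x\rightsquigarrow d(y)$ for all $x,y\in A$.
   Context: A pseudo-BCI algebra is a structure $(A,\to,\rightsquigarrow,1)$ of type $(2,2,0)$ such that for all $x,y,z\in A$: $(x\to y)\rightsquigarrow[(y\to z)\rightsquigarrow(x\to z)]=1$; $(x\rightsquigarrow y)\to[(y\rightsquigarrow z)\to(x\rightsquigarrow z)]=1$; $1\to x=x$; $1\rightsquigarrow x=x$; and $x\to y=1$, $y\to x=1$ imply $x=y$. Put $x\Cup_1 y=(x\to y)\rightsquigarrow y$ and $x\Cup_2 y=(x\rightsquigarrow y)\to y$. A map $d:A\to A$ is a type II implicative derivation if $d(x\to y)=(d(x)\to y)\Cup_2(x\to d(y))$ and $d(x\rightsquigarrow y)=(d(x)\rightsquigarrow y)\Cup_1(x\rightsquigarrow d(y))$ for all $x,y\in A$; it is regular if $d(1)=1$. *)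

theory Defs
  imports Main
begin

text \<open>
  Algebras are given by a carrier set \<open>A\<close> with operations that are constrained only on \<open>A\<close>.
  The two arrows are independent operations: \<open>\<rightarrow>\<close> and \<open>\<leadsto>\<close>.
\<close>

locale pseudo_BCI_algebra =
  fixes A :: "'a set"
    and imp1 :: "'a \<Rightarrow> 'a \<Rightarrow> 'a"  (infixr "\<rightarrow>" 65)
    and imp2 :: "'a \<Rightarrow> 'a \<Rightarrow> 'a"  (infixr "\<leadsto>" 65)
    and one :: 'a  ("\<one>")
  assumes imp1_closed: "x \<in> A \<Longrightarrow> y \<in> A \<Longrightarrow> x \<rightarrow> y \<in> A"
    and imp2_closed: "x \<in> A \<Longrightarrow> y \<in> A \<Longrightarrow> x \<leadsto> y \<in> A"
    and one_closed: "\<one> \<in> A"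
    and psBCI1: "x \<in> A \<Longrightarrow> y \<in> A \<Longrightarrow> z \<in> A \<Longrightarrow>
          (x \<rightarrow> y) \<leadsto> ((y \<rightarrow> z) \<leadsto> (x \<rightarrow> z)) = \<one>"
    and psBCI2: "x \<in> A \<Longrightarrow> y \<in> A \<Longrightarrow> z \<in> A \<Longrightarrow>
          (x \<leadsto> y) \<rightarrow> ((y \<leadsto> z) \<rightarrow> (x \<leadsto> z)) = \<one>"
    and psBCI3: "x \<in> A \<Longrightarrow> \<one> \<rightarrow> x = x"
    and psBCI4: "x \<in> A \<Longrightarrow> \<one> \<leadsto> x = x"
    and psBCI5: "x \<in> A \<Longrightarrow> y \<in> A \<Longrightarrow> x \<rightarrow> y = \<one> \<Longrightarrow> y \<rightarrow> x = \<one> \<Longrightarrow> x = y"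
begin

definition cup1 :: "'a \<Rightarrow> 'a \<Rightarrow> 'a"  (infixl "\<Squnion>\<^sub>1" 60)
  where "x \<Squnion>\<^sub>1 y = (x \<rightarrow> y) \<leadsto> y"

definition cup2 :: "'a \<Rightarrow> 'a \<Rightarrow> 'a"  (infixl "\<Squnion>\<^sub>2" 60)
  where "x \<Squnion>\<^sub>2 y = (x \<leadsto> y) \<rightarrow> y"

definition type_II_implicative_derivation :: "('a \<Rightarrow> 'a) \<Rightarrow> bool"
  where "type_II_implicative_derivation d \<longleftrightarrow>
    (\<forall>x\<in>A. d x \<in> A) \<and>
    (\<forall>x\<in>A. \<forall>y\<in>A. d (x \<rightarrow> y) = (d x \<rightarrow> y) \<Squnion>\<^sub>2 (x \<rightarrow> d y)) \<and>
    (\<forall>x\<in>A. \<forall>y\<in>A. d (x \<leadsto> y) = (d x \<leadsto> y) \<Squnion>\<^sub>1 (x \<leadsto> d y))"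

definition regular :: "('a \<Rightarrow> 'a) \<Rightarrow> bool"
  where "regular d \<longleftrightarrow> d \<one> = \<one>"

end

end

(* Both sides force x \<le> d x for all x, where x \<le> y means x \<rightarrow> y = 1 or, equivalently, x \<leadsto> y = 1:
   in the derivation, d x = d (1 \<leadsto> x) = (x \<rightarrow> d x) \<leadsto> d x, which lies above x; conversely,
   1 = d (x \<rightarrow> x) = x \<rightarrow> d x. Since \<rightarrow> is antitone on the left and isotone on the right, it follows that
   d x \<rightarrow> y \<le> x \<rightarrow> y \<le> x \<rightarrow> d y, and a join of comparable elements collapses to the upper one.
   So the two formulas for d (x \<rightarrow> y) have the same right-hand side. *)

theory Submission
  imports Defs
begin

context pseudo_BCI_algebra
begin

lemma imp1_refl: "x \<in> A \<Longrightarrow> x \<rightarrow> x = \<one>"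
  \<comment> \<open>The unit laws reduce this instance to
    \<open>\<one> \<rightarrow> (x \<rightarrow> x) = \<one>\<close>, and then to the claim.\<close>
  using psBCI2[of \<one> \<one> x] by (simp add: imp1_closed one_closed psBCI3 psBCI4)

lemma le_cup1: "x \<in> A \<Longrightarrow> y \<in> A \<Longrightarrow> x \<leadsto> (x \<Squnion>\<^sub>1 y) = \<one>"
  using psBCI1[of \<one> x y] by (simp add: cup1_def one_closed psBCI3 psBCI4)

lemma le_cup2: "x \<in> A \<Longrightarrow> y \<in> A \<Longrightarrow> x \<rightarrow> (x \<Squnion>\<^sub>2 y) = \<one>"
  using psBCI2[of \<one> x y] by (simp add: cup2_def one_closed psBCI3 psBCI4)

text \<open>If one arrow sends \<open>x\<close>, \<open>y\<close> to \<open>\<one>\<close>, the cup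
  starting with that arrow collapses to \<open>y\<close> by a unit law, while \<open>x\<close> lies
  below that cup for the other arrow. Hence both arrows induce the same order.\<close>

lemma imp1_eq_one_iff: "x \<in> A \<Longrightarrow> y \<in> A \<Longrightarrow> x \<rightarrow> y = \<one> \<longleftrightarrow> x \<leadsto> y = \<one>"
  using le_cup1[of x y] le_cup2[of x y] by (metis cup1_def cup2_def psBCI3 psBCI4)

text \<open>Swapping the arrows exchanges the axioms in pairs; only antisymmetry needs the common
  order.\<close>

lemma dual: "pseudo_BCI_algebra A (\<leadsto>) (\<rightarrow>) \<one>"
  by unfold_locales
    (auto simp: imp1_closed imp2_closed one_closed psBCI1 psBCI2 psBCI3 psBCI4
      imp1_eq_one_iff[symmetric] intro: psBCI5)

lemma cup2_absorb: "x \<in> A \<Longrightarrow> y \<in> A \<Longrightarrow> x \<rightarrow> y = \<one> \<Longrightarrow> x \<Squnion>\<^sub>2 y = y"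
  by (simp add: cup2_def imp1_eq_one_iff psBCI3)

lemma le_trans:
  "x \<in> A \<Longrightarrow> y \<in> A \<Longrightarrow> z \<in> A \<Longrightarrow> x \<rightarrow> y = \<one> \<Longrightarrow> y \<rightarrow> z = \<one> \<Longrightarrow> x \<rightarrow> z = \<one>"
  using psBCI1[of x y z] by (simp add: imp1_closed one_closed psBCI4)

text \<open>The hypothesis turns the first factor of \<open>psBCI1\<close> into
  \<open>\<one>\<close>, which a unit law removes; the remaining \<open>\<leadsto>\<close> becomes
  \<open>\<rightarrow>\<close> by the common order.\<close>

lemma imp1_antitone:
  "x \<in> A \<Longrightarrow> y \<in> A \<Longrightarrow> z \<in> A \<Longrightarrow> x \<rightarrow> y = \<one> \<Longrightarrow> (y \<rightarrow> z) \<rightarrow> (x \<rightarrow> z) = \<one>"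
  using psBCI1[of x y z] by (metis imp1_closed imp1_eq_one_iff imp2_closed psBCI4)

text \<open>Here it is the middle factor of \<open>psBCI1\<close> that becomes
  \<open>\<one>\<close>.\<close>

lemma imp1_mono:
  "x \<in> A \<Longrightarrow> y \<in> A \<Longrightarrow> z \<in> A \<Longrightarrow> y \<rightarrow> z = \<one> \<Longrightarrow> (x \<rightarrow> y) \<rightarrow> (x \<rightarrow> z) = \<one>"
  using psBCI1[of x y z] by (metis imp1_closed imp1_eq_one_iff imp2_closed psBCI4)

lemma cup2_collapse:
  assumes cl: "\<And>x. x \<in> A \<Longrightarrow> d x \<in> A" and ext: "\<And>x. x \<in> A \<Longrightarrow> x \<rightarrow> d x = \<one>"
    and "x \<in> A" "y \<in> A"
  shows "(d x \<rightarrow> y) \<Squnion>\<^sub>2 (x \<rightarrow> d y) = x \<rightarrow> d y"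
proof (rule cup2_absorb)
  show "(d x \<rightarrow> y) \<rightarrow> (x \<rightarrow> d y) = \<one>"
    using le_trans[of "d x \<rightarrow> y" "x \<rightarrow> y" "x \<rightarrow> d y"] imp1_antitone[of x "d x" y] imp1_mono[of x y "d y"]
    by (simp add: assms imp1_closed)
qed (simp_all add: assms imp1_closed)

lemma cup1_collapse:
  assumes "\<And>x. x \<in> A \<Longrightarrow> d x \<in> A" "\<And>x. x \<in> A \<Longrightarrow> x \<rightarrow> d x = \<one>" "x \<in> A" "y \<in> A"
  shows "(d x \<leadsto> y) \<Squnion>\<^sub>1 (x \<leadsto> d y) = x \<leadsto> d y"
proof -
  interpret dual: pseudo_BCI_algebra A "(\<leadsto>)" "(\<rightarrow>)" \<one>
    by (rule dual)
  show ?thesis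
    \<comment> \<open>In the swapped algebra \<open>cup2\<close> is the original
      \<open>cup1\<close>, and the extensivity hypothesis carries over because the order is the
      same.\<close>
    using dual.cup2_collapse[of d x y] assms
    by (simp add: dual.cup2_def cup1_def imp1_eq_one_iff)
qed

lemma le_regular_derivation:
  assumes "type_II_implicative_derivation d" "regular d" "x \<in> A"
  shows "x \<rightarrow> d x = \<one>"
proof -
  have cl: "d x \<in> A"
    using assms by (simp add: type_II_implicative_derivation_def)
  have "d (\<one> \<leadsto> x) = (d \<one> \<leadsto> x) \<Squnion>\<^sub>1 (\<one> \<leadsto> d x)"
    using assms one_closed by (simp add: type_II_implicative_derivation_def)
  then have "d x = x \<Squnion>\<^sub>1 d x"
    using assms cl by (simp add: regular_def psBCI4)
  then show ?thesis
    using le_cup1[of x "d x"] assms cl by (simp add: imp1_eq_one_iff)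
qed

lemma regular_type_II_derivation_iff:
  assumes cl: "\<And>x. x \<in> A \<Longrightarrow> d x \<in> A"
  shows "type_II_implicative_derivation d \<and> regular d \<longleftrightarrow>
    d \<one> = \<one> \<and> (\<forall>x\<in>A. \<forall>y\<in>A. d (x \<rightarrow> y) = x \<rightarrow> d y) \<and> (\<forall>x\<in>A. \<forall>y\<in>A. d (x \<leadsto> y) = x \<leadsto> d y)"
    (is "?L \<longleftrightarrow> ?R")
proof -
  \<comment> \<open>Once \<open>d\<close> is extensive, both collapse lemmas turn one side into the
    other. Extensivity is then drawn from whichever side is assumed.\<close>
  have iff: "?L \<longleftrightarrow> ?R" if ext: "\<And>x. x \<in> A \<Longrightarrow> x \<rightarrow> d x = \<one>"
    using cup1_collapse[of d, OF cl ext] cup2_collapse[of d, OF cl ext] cl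
    by (auto simp: type_II_implicative_derivation_def regular_def)
  have "x \<rightarrow> d x = \<one>" if "?R" "x \<in> A" for x
    using that imp1_refl[of x] by metis
  then show ?thesis
    using iff le_regular_derivation by blast
qed

end

theorem theorem3p23:
  fixes A :: "'a set"
    and imp1 :: "'a \<Rightarrow> 'a \<Rightarrow> 'a"  (infixr "\<rightarrow>" 65)
    and imp2 :: "'a \<Rightarrow> 'a \<Rightarrow> 'a"  (infixr "\<leadsto>" 65)
    and one :: 'a  ("\<one>")
    and d :: "'a \<Rightarrow> 'a"
  assumes "pseudo_BCI_algebra A (\<rightarrow>) (\<leadsto>) \<one>"
    and "\<forall>x\<in>A. d x \<in> A"
  shows "pseudo_BCI_algebra.type_II_implicative_derivation A (\<rightarrow>) (\<leadsto>) d \<and>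
           pseudo_BCI_algebra.regular \<one> d
         \<longleftrightarrow> d \<one> = \<one> \<and>
             (\<forall>x\<in>A. \<forall>y\<in>A. d (x \<rightarrow> y) = x \<rightarrow> d y) \<and>
             (\<forall>x\<in>A. \<forall>y\<in>A. d (x \<leadsto> y) = x \<leadsto> d y)"
  using pseudo_BCI_algebra.regular_type_II_derivation_iff[of A imp1 imp2 one d] assms
  by blast

end
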